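(* Let $L \geq 1$, let $A_i \in \mathbb{R}^{s \times s}$ and $B_i \in \mathbb{R}^{s \times a}$ for $i = 1,\ldots,L$, and consider the polytopic linear differential inclusion $$\dot{x}(t) = A(t)x(t) + B(t)u(t), \qquad (A(t),B(t)) \in \mathrm{Conv}\{(A_1,B_1), \ldots, (A_L,B_L)\}.$$ Let $\alpha > 0$, and let $V(x) = x^T P x$ where $P = S^{-1}$ for some symmetric $S \in \mathbb{R}^{s \times s}$ with $S \succ 0$ and some $Y \in \mathbb{R}^{a \times s}$ satisfying $$A_{i}S + B_{i} Y + S A_{i}^T + Y^T B_{i}^T + \alpha S \preceq 0 \quad \text{for all } i=1,\ldots,L$$ (such a $P$ being assumed to exist). For every $x \in \mathbb{R}^s$ define $$\mathcal{C}_{\text{PLDI}}(x) := \left\{ u \in \mathbb{R}^a \;\middle|\; \begin{bmatrix} 2x^T P B_1 \\ 2x^T P B_2 \\ \vdots \\ 2x^T P B_L \end{bmatrix} u \leq - \begin{bmatrix} x^T (\alpha P + 2P A_1) x \\ x^T (\alpha P + 2P A_2) x \\ \vdots \\ x^T (\alpha P + 2P A_L) x \end{bmatrix} \right\},$$ with the inequality understood entrywise. Then for every $x \in \mathbb{R}^s$: (i) $\mathcal{C}_{\text{PLDI}}(x)$ is non-empty; (ii) every $u \in \mathcal{C}_{\text{PLDI}}(x)$ satisfies the exponential stability condition $\dot{V}(x) \leq -\alpha V(x)$ for every admissible pair $(A(t),B(t)) \in \mathrm{Conv}\{(A_1,B_1), \ldots, (A_L,B_L)\}$; and (iii) $\mathcal{C}_{\text{PLDI}}(x)$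 is a convex subset of $\mathbb{R}^a$.
   Context: $\mathrm{Conv}$ denotes the convex hull; $A(t), B(t)$ may vary arbitrarily in time within it. For a given state $x$, action $u$ and pair $(A(t),B(t))$, $\dot{V}(x)$ denotes the derivative of $V$ along the dynamics, $\dot{V}(x) = \dot{x}^T P x + x^T P \dot{x}$ with $\dot{x} = A(t)x + B(t)u$. The symbols $\preceq, \succ$ refer to the semidefinite order on symmetric matrices. *)

theory Defs
  imports "HOL-Analysis.Analysis"
begin

definition positive_semidefinite :: "real^'n^'n \<Rightarrow> bool" where
  "positive_semidefinite M \<longleftrightarrow> transpose M = M \<and> (\<forall>x. 0 \<le> x \<bullet> (M *v x))"

definition positive_definite :: "real^'n^'n \<Rightarrow> bool" where
  "positive_definite M \<longleftrightarrow> transpose M = M \<and> (\<forall>x. x \<noteq> 0 \<longrightarrow> 0 < x \<bullet> (M *v x))"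

text \<open>A separate symbol, because \<open>\<le>\<close> on matrices is the entrywise order.\<close>

definition semidefinite_le :: "real^'n^'n \<Rightarrow> real^'n^'n \<Rightarrow> bool"  (infix \<open>\<preceq>\<close> 50) where
  "M \<preceq> N \<longleftrightarrow> positive_semidefinite (N - M)"

definition lyap :: "real^'s^'s \<Rightarrow> real^'s \<Rightarrow> real" where
  "lyap P x = x \<bullet> (P *v x)"

definition lyap_deriv ::
    "real^'s^'s \<Rightarrow> real^'s^'s \<Rightarrow> real^'a^'s \<Rightarrow> real^'s \<Rightarrow> real^'a \<Rightarrow> real" where
  "lyap_deriv P A B x u =
     (let xdot = A *v x + B *v u in xdot \<bullet> (P *v x) + x \<bullet> (P *v xdot))"

lemma lyap_has_derivative_along_dynamics:
  assumes "(\<xi> has_vector_derivative (A *v \<xi> t + B *v u)) (at t within T)"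
  shows "((\<lambda>t. lyap P (\<xi> t)) has_real_derivative lyap_deriv P A B (\<xi> t) u) (at t within T)"
proof -
  have "((\<lambda>t. P *v \<xi> t) has_vector_derivative (P *v (A *v \<xi> t + B *v u))) (at t within T)"
    by (rule bounded_linear.has_vector_derivative[OF matrix_vector_mul_bounded_linear assms])
  from bounded_bilinear.has_vector_derivative[OF bounded_bilinear_inner assms this]
  show ?thesis
    by (simp add: lyap_def lyap_deriv_def Let_def has_real_derivative_iff_has_vector_derivative
        add.commute)
qed

text \<open>
  The vertices of the polytope are indexed by a finite type \<open>'l\<close> with \<open>CARD('l) = L\<close> (so
  \<open>L \<ge> 1\<close>); row \<open>i\<close> of the stacked matrix is \<open>2 x\<^sup>T P B\<^sub>i\<close>. The order \<open>\<le>\<close> on vectors is entrywise.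
\<close>

definition pldi_lhs ::
    "('l::finite \<Rightarrow> real^'a^'s) \<Rightarrow> real^'s^'s \<Rightarrow> real^'s \<Rightarrow> real^'a^'l" where
  "pldi_lhs B P x = (\<chi> i. 2 *\<^sub>R (x v* (P ** B i)))"

definition pldi_rhs ::
    "('l::finite \<Rightarrow> real^'s^'s) \<Rightarrow> real^'s^'s \<Rightarrow> real \<Rightarrow> real^'s \<Rightarrow> real^'l" where
  "pldi_rhs A P \<alpha> x = - (\<chi> i. x \<bullet> ((\<alpha> *\<^sub>R P + 2 *\<^sub>R (P ** A i)) *v x))"

definition C_PLDI ::
    "('l::finite \<Rightarrow> real^'s^'s) \<Rightarrow> ('l \<Rightarrow> real^'a^'s) \<Rightarrow> real^'s^'s \<Rightarrow> real \<Rightarrow> real^'s \<Rightarrow> (real^'a) set"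
  where "C_PLDI A B P \<alpha> x = {u. pldi_lhs B P x *v u \<le> pldi_rhs A P \<alpha> x}"

end

theory Submission
  imports Defs
begin

text \<open>
  For symmetric \<open>P\<close>, the \<open>i\<close>-th row of the constraint says exactly that the decay condition holds at
  the vertex \<open>(A\<^sub>i, B\<^sub>i)\<close>. The derivative is linear in \<open>(A, B)\<close>, so the condition passes to the convex
  hull. The matrix inequality, evaluated at \<open>z = P x\<close> (so \<open>x = S z\<close>), shows that the linear feedback
  \<open>u = Y P x\<close> is feasible at all vertices simultaneously.
\<close>

lemma inner_matrix_vector_mult_transpose:
  fixes M :: "real^'n^'m"
  shows "x \<bullet> (transpose M *v y) = (M *v x) \<bullet> y"
  by (metis dot_lmul_matrix inner_commute transpose_matrix_vector)

lemma inner_matrix_vector_mult_symmetric: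
  fixes M :: "real^'n^'n"
  assumes "transpose M = M"
  shows "x \<bullet> (M *v y) = (M *v x) \<bullet> y"
  by (metis assms inner_matrix_vector_mult_transpose)

text \<open>The kernel is trivial, since \<open>S *v x = 0\<close> would make the quadratic form
  vanish at \<open>x\<close>.\<close>

lemma positive_definite_imp_invertible:
  assumes "positive_definite S"
  shows "invertible S"
proof -
  have "x = 0" if "S *v x = 0" for x
    using assms that unfolding positive_definite_def by (metis inner_zero_right less_irrefl)
  then show ?thesis
    by (simp add: invertible_left_inverse matrix_left_invertible_ker)
qed

lemma matrix_mul_matrix_inv:
  assumes "invertible S"
  shows "S ** matrix_inv S = mat 1"
  using assms someI_ex[of "\<lambda>S'. S ** S' = mat 1 \<and> S' ** S = mat 1"]
  unfolding invertible_def matrix_inv_def by auto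

lemma transpose_matrix_inv_symmetric:
  fixes S :: "real^'n^'n"
  assumes "invertible S" and "transpose S = S"
  shows "transpose (matrix_inv S) = matrix_inv S"
proof -
  \<comment> \<open>Inserting the identity as \<open>S ** matrix_inv S\<close> lets the symmetry of
    \<open>S\<close> turn the first two factors into the transpose of that same product.\<close>
  have "transpose (matrix_inv S) = transpose (matrix_inv S) ** (S ** matrix_inv S)"
    by (simp add: matrix_mul_matrix_inv[OF assms(1)])
  also have "\<dots> = transpose (S ** matrix_inv S) ** matrix_inv S"
    by (simp only: matrix_transpose_mul assms(2) matrix_mul_assoc)
  also have "\<dots> = matrix_inv S"
    by (simp add: matrix_mul_matrix_inv[OF assms(1)] transpose_mat)
  finally show ?thesis .
qed

lemma lyap_deriv_symmetric:
  assumes "transpose P = P"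
  shows "lyap_deriv P A B x u = 2 * ((P *v x) \<bullet> (A *v x + B *v u))"
  by (simp add: lyap_deriv_def Let_def inner_matrix_vector_mult_symmetric[OF assms, of x] inner_commute)

text \<open>Symmetry of \<open>P\<close> merges the two halves of the derivative into
  \<open>2 * ((P *v x) \<bullet> (A i *v x + B i *v u))\<close>; its drift part sits on the right of
  row \<open>i\<close>, its input part on the left.\<close>

lemma mem_C_PLDI_iff:
  assumes "transpose P = P"
  shows "u \<in> C_PLDI A B P \<alpha> x \<longleftrightarrow> (\<forall>i. lyap_deriv P (A i) (B i) x u \<le> - \<alpha> * lyap P x)"
proof -
  have row: "(pldi_lhs B P x *v u) $ i = 2 * ((P *v x) \<bullet> (B i *v u))" for i
  proof -
    have "(pldi_lhs B P x *v u) $ i = 2 * ((x v* (P ** B i)) \<bullet> u)"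
      by (simp add: pldi_lhs_def matrix_vector_mul_component)
    also have "\<dots> = 2 * (x \<bullet> (P *v (B i *v u)))"
      by (simp add: dot_lmul_matrix matrix_vector_mul_assoc)
    finally show ?thesis
      by (simp add: inner_matrix_vector_mult_symmetric[OF assms])
  qed
  have rhs: "pldi_rhs A P \<alpha> x $ i = - \<alpha> * lyap P x - 2 * ((P *v x) \<bullet> (A i *v x))" for i
    by (simp add: pldi_rhs_def lyap_def matrix_vector_mult_add_rdistrib scaleR_matrix_vector_assoc[symmetric]
        matrix_vector_mul_assoc[symmetric] inner_add_right
        inner_matrix_vector_mult_symmetric[OF assms])
  show ?thesis
    by (auto simp: C_PLDI_def less_eq_vec_def row rhs lyap_deriv_symmetric[OF assms] inner_add_right
        algebra_simps)
qed

text \<open>Each row cuts out a half-space in \<open>u\<close>, and an intersection of half-spaces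
  is convex.\<close>

lemma convex_C_PLDI: "convex (C_PLDI A B P \<alpha> x)"
proof -
  have "C_PLDI A B P \<alpha> x = (\<Inter>i. {u. (pldi_lhs B P x $ i) \<bullet> u \<le> pldi_rhs A P \<alpha> x $ i})"
    by (auto simp: C_PLDI_def less_eq_vec_def matrix_vector_mul_component)
  then show ?thesis
    by (simp add: convex_INT convex_halfspace_le)
qed

text \<open>With \<open>x\<close> and \<open>u\<close> fixed, linearity is joint in the pair, that
  is, on the product space in which the convex hull is taken.\<close>

lemma linear_lyap_deriv: "linear (\<lambda>(A, B). lyap_deriv P A B x u)"
  by (rule linearI)
    (auto simp: lyap_deriv_def Let_def matrix_vector_mult_add_rdistrib matrix_vector_right_distrib
      scaleR_matrix_vector_assoc[symmetric] matrix_vector_mult_scaleR inner_add_left inner_add_right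
      algebra_simps)

text \<open>A sublevel set of a linear functional is convex, so once it contains the vertices it
  contains their hull.\<close>

lemma lyap_deriv_le_convex_hull:
  assumes "\<forall>i. lyap_deriv P (A i) (B i) x u \<le> c"
    and "(A', B') \<in> convex hull (range (\<lambda>i. (A i, B i)))"
  shows "lyap_deriv P A' B' x u \<le> c"
proof -
  let ?H = "(\<lambda>(A, B). lyap_deriv P A B x u) -` {..c}"
  have "convex ?H"
    by (intro convex_linear_vimage linear_lyap_deriv convex_real_interval)
  then have "convex hull (range (\<lambda>i. (A i, B i))) \<subseteq> ?H"
    using assms(1) by (intro hull_minimal) auto
  then show ?thesis
    using assms(2) by auto
qed

lemma feedback_decay:
  assumes sym: "transpose S = S" "transpose P = P" and inv: "S ** P = mat 1"
    and lmi: "A ** S + B ** Y + S ** transpose A + transpose Y ** transpose B + \<alpha> *\<^sub>R S \<preceq> 0"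
  shows "lyap_deriv P A B x (Y *v (P *v x)) \<le> - \<alpha> * lyap P x"
proof -
  define z where "z = P *v x"
  have x: "S *v z = x"
    by (simp add: z_def matrix_vector_mul_assoc inv)
  have "M \<preceq> 0 \<Longrightarrow> z \<bullet> (M *v z) \<le> 0" for M
    unfolding semidefinite_le_def positive_semidefinite_def
    by (metis diff_0 inner_diff_right inner_zero_right matrix_vector_mult_0
        matrix_vector_mult_diff_rdistrib neg_0_le_iff_le)
  from this[OF lmi]
  have "z \<bullet> ((A ** S + B ** Y + S ** transpose A + transpose Y ** transpose B + \<alpha> *\<^sub>R S) *v z) \<le> 0" .
  \<comment> \<open>As scalars, the two transposed terms equal the two untransposed ones; this
    produces the factor 2 of the derivative.\<close>
  moreover have "z \<bullet> (S *v (transpose A *v z)) = z \<bullet> (A *v x)"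
    using x by (metis inner_matrix_vector_mult_symmetric[OF sym(1)]
        inner_matrix_vector_mult_transpose inner_commute)
  moreover have "z \<bullet> (transpose Y *v (transpose B *v z)) = z \<bullet> (B *v (Y *v z))"
    by (metis inner_matrix_vector_mult_transpose inner_commute)
  ultimately have "2 * (z \<bullet> (A *v x + B *v (Y *v z))) + \<alpha> * (z \<bullet> x) \<le> 0"
    by (simp add: matrix_vector_mult_add_rdistrib scaleR_matrix_vector_assoc[symmetric]
        \<comment> \<open>The deleted simp rule would rewrite \<open>transpose M *v y\<close> to
          \<open>y v* M\<close>; without it the transposed terms keep the shape of the two
          identities above.\<close>
        matrix_vector_mul_assoc[symmetric] inner_add_right x del: transpose_matrix_vector)
  then show ?thesis
    by (simp add: lyap_deriv_symmetric[OF sym(2)] lyap_def z_def inner_commute)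
qed

theorem theoremB1:
  fixes A :: "'l::finite \<Rightarrow> real^'s^'s"
    and B :: "'l \<Rightarrow> real^'a^'s"
    and S P :: "real^'s^'s"
    and Y :: "real^'s^'a"
    and \<alpha> :: real
  assumes "\<alpha> > 0"
    and "positive_definite S"
    and "\<forall>i. A i ** S + B i ** Y + S ** transpose (A i) + transpose Y ** transpose (B i)
              + \<alpha> *\<^sub>R S \<preceq> 0"
    and "P = matrix_inv S"
  shows "\<forall>x. C_PLDI A B P \<alpha> x \<noteq> {}
           \<and> (\<forall>u \<in> C_PLDI A B P \<alpha> x. \<forall>(A', B') \<in> convex hull (range (\<lambda>i. (A i, B i))).
                 lyap_deriv P A' B' x u \<le> - \<alpha> * lyap P x)
           \<and> convex (C_PLDI A B P \<alpha> x)"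
proof -
  have sym_S: "transpose S = S" and inv_S: "invertible S"
    using assms(2) positive_definite_imp_invertible by (auto simp: positive_definite_def)
  have sym_P: "transpose P = P" and inv: "S ** P = mat 1"
    using sym_S inv_S assms(4) by (simp_all add: transpose_matrix_inv_symmetric matrix_mul_matrix_inv)
  have "Y *v (P *v x) \<in> C_PLDI A B P \<alpha> x" for x
    \<comment> \<open>The gain \<open>Y\<close> is common to all vertices, so this single input
      satisfies every row.\<close>
    unfolding mem_C_PLDI_iff[OF sym_P] using feedback_decay[OF sym_S sym_P inv] assms(3) by blast
  moreover have "lyap_deriv P A' B' x u \<le> - \<alpha> * lyap P x"
    if "u \<in> C_PLDI A B P \<alpha> x" and "(A', B') \<in> convex hull (range (\<lambda>i. (A i, B i)))" for x u A' B'
    using that lyap_deriv_le_convex_hull unfolding mem_C_PLDI_iff[OF sym_P] by blast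
  ultimately show ?thesis
    using convex_C_PLDI by blast
qed

end
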